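(* Let $p$ be a prime and let $L = \mathbb{Z}/p\wr\mathbb{Z} \cong \mathbb{F}_p[t,t^{-1}]\rtimes\mathbb{Z}$ be the $p$-lamplighter group. Then any finite-index subgroup of $L$ is a congruence subgroup.
   Context: The lamplighter group $L=\mathbb{Z}/p\wr\mathbb{Z}$ is identified with the group of pairs $(f(t),k)$, $f(t)\in\mathbb{F}_p[t,t^{-1}]$, $k\in\mathbb{Z}$, with multiplication $(f_1,k_1)(f_2,k_2) = (f_1+t^{k_1}f_2,\ k_1+k_2)$; equivalently $L=\mathbb{F}_p[t,t^{-1}]\rtimes\mathbb{Z}$, where $k\in\mathbb{Z}$ acts on the additive group $\mathbb{F}_p[t,t^{-1}]$ as multiplication by $t^k$. A finite-index normal subgroup $\Delta$ of $L$ is a principal congruence subgroup if it is the kernel of a surjective homomorphism of the form $$ r: L\to \left(\mathbb{F}_p[t,t^{-1}]/(g(t))\right)\rtimes \mathbb{Z}/k ,$$ for some $g(t)\in\mathbb{F}_p[t,t^{-1}]$ and some positive integer $k$, where the generator $1\in\mathbb{Z}/k$ acts on $\mathbb{F}_p[t,t^{-1}]/(g(t))$ as multiplication by $t$ (so that $t^k\equiv 1$ modulo $g(t)$ for the semidirect product to be defined). A finite-index subgroup of $L$ is a congruence subgroup if it contains a principal congruence subgroup. *)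

theory Defs
  imports
    "HOL-Algebra.Algebra"
    "HOL-Algebra.Algebraic_Closure_Type"
    "HOL-Library.Poly_Mapping"
    "Berlekamp_Zassenhaus.Finite_Field"
begin

text \<open>
  Laurent polynomials are the finitely supported functions from the integers to the coefficients;
  multiplication on \<^typ>\<open>int \<Rightarrow>\<^sub>0 'a\<close> is convolution. The coefficient field of order \<open>p\<close> is
  \<^typ>\<open>'p mod_ring\<close> with \<^class>\<open>prime_card\<close>, so that \<open>p = CARD('p)\<close>.
\<close>

type_synonym 'p laurent = "int \<Rightarrow>\<^sub>0 'p mod_ring"

definition tpow :: "int \<Rightarrow> 'p::prime_card laurent" where
  "tpow n = Poly_Mapping.single n 1"

lemma tpow_0: "tpow 0 = 1"
  by (simp add: tpow_def)

lemma tpow_add: "tpow (m + n) = tpow m * tpow n"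
  by (simp add: tpow_def mult_single)

abbreviation laurent_ring :: "'p::prime_card laurent ring" where
  "laurent_ring \<equiv> ring_of_type_algebra"

definition semidirect ::
  "('a, 'c) monoid_scheme \<Rightarrow> ('b, 'd) monoid_scheme \<Rightarrow> ('b \<Rightarrow> 'a \<Rightarrow> 'a) \<Rightarrow> ('a \<times> 'b) monoid" where
  "semidirect A B \<phi> =
     \<lparr>carrier = carrier A \<times> carrier B,
      monoid.mult = (\<lambda>(a, b) (a', b'). (a \<otimes>\<^bsub>A\<^esub> \<phi> b a', b \<otimes>\<^bsub>B\<^esub> b')),
      one = (\<one>\<^bsub>A\<^esub>, \<one>\<^bsub>B\<^esub>)\<rparr>"

definition lamplighter :: "('p::prime_card laurent \<times> int) monoid" where
  "lamplighter = semidirect (add_monoid laurent_ring) integer_group (\<lambda>n f. tpow n * f)"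

lemma lamplighter_mult:
  "(f\<^sub>1, k\<^sub>1) \<otimes>\<^bsub>lamplighter\<^esub> (f\<^sub>2, k\<^sub>2) = (f\<^sub>1 + tpow k\<^sub>1 * f\<^sub>2, k\<^sub>1 + k\<^sub>2)"
  by (simp add: lamplighter_def semidirect_def ring_of_type_algebra_def integer_group_def)

text \<open>
  The class of \<open>n\<close> in \<open>\<int>/k\<close> is represented by \<open>n \<in> {0..<k}\<close>. The semidirect product is only
  meaningful when \<open>t\<^sup>k\<close> is congruent to 1 modulo \<open>g\<close>; this is imposed where it is used.
\<close>

definition congruence_quotient ::
  "'p::prime_card laurent \<Rightarrow> nat \<Rightarrow> ('p laurent set \<times> int) monoid" where
  "congruence_quotient g k =
     (let I = PIdl\<^bsub>laurent_ring\<^esub> g; Q = laurent_ring Quot I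
      in semidirect (add_monoid Q) (integer_mod_group k)
           (\<lambda>n x. (I +>\<^bsub>laurent_ring\<^esub> tpow n) \<otimes>\<^bsub>Q\<^esub> x))"

definition reduction ::
  "'p::prime_card laurent \<Rightarrow> nat \<Rightarrow> 'p laurent \<times> int \<Rightarrow> 'p laurent set \<times> int" where
  "reduction g k = (\<lambda>(f, n). ((PIdl\<^bsub>laurent_ring\<^esub> g) +>\<^bsub>laurent_ring\<^esub> f, n mod int k))"

definition finite_index_subgroup :: "'a set \<Rightarrow> ('a, 'b) monoid_scheme \<Rightarrow> bool" where
  "finite_index_subgroup H G \<longleftrightarrow> subgroup H G \<and> finite (rcosets\<^bsub>G\<^esub> H)"

text \<open>
  The homomorphism defining a principal congruence subgroup is the canonical one, reducing the
  first component modulo \<open>g\<close> and the second modulo \<open>k\<close>.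
\<close>

definition principal_congruence_subgroup :: "('p::prime_card laurent \<times> int) set \<Rightarrow> bool" where
  "principal_congruence_subgroup \<Delta> \<longleftrightarrow>
     finite_index_subgroup \<Delta> lamplighter \<and> \<Delta> \<lhd> lamplighter \<and>
     (\<exists>g k. k > 0 \<and> tpow (int k) - 1 \<in> PIdl\<^bsub>laurent_ring\<^esub> g \<and>
        reduction g k \<in> epi lamplighter (congruence_quotient g k) \<and>
        \<Delta> = kernel lamplighter (congruence_quotient g k) (reduction g k))"

definition congruence_subgroup :: "('p::prime_card laurent \<times> int) set \<Rightarrow> bool" where
  "congruence_subgroup H \<longleftrightarrow>
     finite_index_subgroup H lamplighter \<and>
     (\<exists>\<Delta>. principal_congruence_subgroup \<Delta> \<and> \<Delta> \<subseteq> H)"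

lemma cring_laurent: "cring (laurent_ring :: 'p::prime_card laurent ring)"
  by (rule cring_from_type_algebra)

lemma ideal_PIdl_laurent: "ideal (PIdl\<^bsub>laurent_ring\<^esub> g) (laurent_ring :: 'p::prime_card laurent ring)"
  by (rule cring.cgenideal_ideal[OF cring_laurent]) (simp add: ring_of_type_algebra_def)

lemma group_lamplighter: "group (lamplighter :: ('p::prime_card laurent \<times> int) monoid)"
proof (rule groupI)
  fix x :: "'p laurent \<times> int"
  obtain f n where x: "x = (f, n)" by (cases x)
  have "(- (tpow (- n) * f), - n) \<otimes>\<^bsub>lamplighter\<^esub> x = \<one>\<^bsub>lamplighter\<^esub>"
    by (simp add: x lamplighter_mult)
       (simp add: lamplighter_def semidirect_def ring_of_type_algebra_def integer_group_def)
  then show "\<exists>y\<in>carrier lamplighter. y \<otimes>\<^bsub>lamplighter\<^esub> x = \<one>\<^bsub>lamplighter\<^esub>"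
    by (rule bexI) (simp add: lamplighter_def semidirect_def ring_of_type_algebra_def integer_group_def)
qed (auto simp: lamplighter_def semidirect_def ring_of_type_algebra_def integer_group_def
       tpow_add tpow_0 algebra_simps)

lemma reduction_epi:
  assumes "k > 0" and t: "tpow (int k) - 1 \<in> PIdl\<^bsub>laurent_ring\<^esub> (g :: 'p::prime_card laurent)"
  shows "reduction g k \<in> epi lamplighter (congruence_quotient g k)"
proof -
  define R where "R = (laurent_ring :: 'p laurent ring)"
  define I where "I = PIdl\<^bsub>R\<^esub> g"
  have R: "carrier R = UNIV" "\<And>a b. a \<otimes>\<^bsub>R\<^esub> b = a * b" "\<And>a b. a \<oplus>\<^bsub>R\<^esub> b = a + b"
    "\<one>\<^bsub>R\<^esub> = 1" "\<zero>\<^bsub>R\<^esub> = 0"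
    by (simp_all add: R_def ring_of_type_algebra_def)
  interpret cring R unfolding R_def by (rule cring_laurent)
  interpret I: ideal I R unfolding I_def R_def by (rule ideal_PIdl_laurent)
  have I_iff: "a \<in> I \<longleftrightarrow> g dvd a" for a
    by (auto simp: I_def cgenideal_def R dvd_def mult.commute)
  have coset: "I +>\<^bsub>R\<^esub> a = I +>\<^bsub>R\<^esub> b" if "g dvd a - b" for a b
  proof -
    have "a \<in> I +>\<^bsub>R\<^esub> b"
      using that by (auto simp: a_r_coset_def r_coset_def R I_iff intro!: bexI[of _ "a - b"])
    then show ?thesis
      using a_repr_independence[of a I b] I.a_subgroup by (simp add: R)
  qed
  have pow: "g dvd tpow (int k * int j) - 1" for j :: nat
  proof (induction j)
    case (Suc j)
    have "tpow (int k * int (Suc j)) - (1 :: 'p laurent)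
        = tpow (int k) * (tpow (int k * int j) - 1) + (tpow (int k) - 1)"
      by (simp add: tpow_add[symmetric] algebra_simps)
    moreover have "g dvd tpow (int k) - 1" using t I_iff by (simp add: I_def R_def)
    ultimately show ?case using Suc by (metis dvd_add dvd_mult)
  qed (simp add: tpow_0)
  have pow': "g dvd tpow (int k * z) - 1" for z :: int
  proof (cases "z \<ge> 0")
    case True then show ?thesis using pow[of "nat z"] by simp
  next
    case False
    have "tpow (int k * z) - (1 :: 'p laurent) = - (tpow (int k * z)) * (tpow (int k * (- z)) - 1)"
      by (simp add: tpow_add[symmetric] algebra_simps tpow_0)
    then show ?thesis using pow[of "nat (-z)"] False
      by (metis dvd_mult int_nat_eq neg_0_le_iff_le linorder_le_cases)
  qed
  have modk: "g dvd tpow n - tpow (n mod int k)" for n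
  proof -
    have "tpow n - (tpow (n mod int k) :: 'p laurent)
        = tpow (n mod int k) * (tpow (int k * (n div int k)) - 1)"
      by (simp add: tpow_add[symmetric] right_diff_distrib)
    then show ?thesis using pow' by (metis dvd_mult)
  qed
  note defs = congruence_quotient_def reduction_def semidirect_def lamplighter_def Let_def
    integer_group_def integer_mod_group_def FactRing_def
  have hom: "reduction g k \<in> hom lamplighter (congruence_quotient g k)"
  proof (rule homI)
    fix x :: "'p laurent \<times> int" assume "x \<in> carrier lamplighter"
    then show "reduction g k x \<in> carrier (congruence_quotient g k)"
      using \<open>k > 0\<close>
      by (cases x) (auto simp: defs A_RCOSETS_def' R R_def[symmetric] I_def[symmetric])
  next
    fix x y :: "'p laurent \<times> int"
    obtain a m b n where x: "x = (a, m)" and y: "y = (b, n)" by (cases x, cases y)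
    have eq: "rcoset_mult R I (I +>\<^bsub>R\<^esub> tpow (m mod int k)) (I +>\<^bsub>R\<^esub> b)
          = I +>\<^bsub>R\<^esub> (tpow (m mod int k) * b)"
      using I.rcoset_mult_add[of "tpow (m mod int k)" b] by (simp add: R)
    have eq2: "(I +>\<^bsub>R\<^esub> a) <+>\<^bsub>R\<^esub> (I +>\<^bsub>R\<^esub> (tpow (m mod int k) * b))
        = I +>\<^bsub>R\<^esub> (a + tpow (m mod int k) * b)"
      using I.a_rcos_sum[of a "tpow (m mod int k) * b"] by (simp add: R)
    have eq3: "I +>\<^bsub>R\<^esub> (a + tpow m * b) = I +>\<^bsub>R\<^esub> (a + tpow (m mod int k) * b)"
      using modk[of m] by (intro coset) (simp add: left_diff_distrib[symmetric])
    have "reduction g k (x \<otimes>\<^bsub>lamplighter\<^esub> y) = (I +>\<^bsub>R\<^esub> (a + tpow m * b), (m + n) mod int k)"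
      by (simp add: x y lamplighter_mult reduction_def I_def R_def)
    moreover have "reduction g k x \<otimes>\<^bsub>congruence_quotient g k\<^esub> reduction g k y
        = ((I +>\<^bsub>R\<^esub> a) <+>\<^bsub>R\<^esub> rcoset_mult R I (I +>\<^bsub>R\<^esub> tpow (m mod int k)) (I +>\<^bsub>R\<^esub> b),
           (m + n) mod int k)"
      using \<open>k > 0\<close> by (simp add: x y defs R_def[symmetric] I_def[symmetric] mod_add_eq)
    ultimately show "reduction g k (x \<otimes>\<^bsub>lamplighter\<^esub> y)
        = reduction g k x \<otimes>\<^bsub>congruence_quotient g k\<^esub> reduction g k y"
      by (simp add: eq eq2 eq3)
  qed
  have "carrier (congruence_quotient g k) \<subseteq> reduction g k ` carrier lamplighter"
  proof
    fix z assume "z \<in> carrier (congruence_quotient g k)"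
    then obtain a n where "z = (I +>\<^bsub>R\<^esub> a, n)" "n \<in> {0..<int k}"
      using \<open>k > 0\<close> by (auto simp: defs A_RCOSETS_def' R R_def[symmetric] I_def[symmetric])
    then have "z = reduction g k (a, n)"
      by (simp add: reduction_def R_def I_def)
    then show "z \<in> reduction g k ` carrier lamplighter"
      by (auto simp: lamplighter_def semidirect_def ring_of_type_algebra_def integer_group_def)
  qed
  then show ?thesis using hom by (auto simp: epi_def hom_def)
qed

lemma group_congruence_quotient:
  assumes "k > 0" and "tpow (int k) - 1 \<in> PIdl\<^bsub>laurent_ring\<^esub> (g :: 'p::prime_card laurent)"
  shows "group (congruence_quotient g k)"
proof -
  let ?L = "lamplighter :: ('p laurent \<times> int) monoid"
  let ?Q = "congruence_quotient g k"
  have epi: "reduction g k \<in> hom ?L ?Q" "reduction g k ` carrier ?L = carrier ?Q"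
    using reduction_epi[OF assms] by (auto simp: epi_def)
  have "PIdl\<^bsub>laurent_ring\<^esub> g +>\<^bsub>laurent_ring\<^esub> 0 = PIdl\<^bsub>laurent_ring\<^esub> g"
    by (simp add: a_r_coset_def r_coset_def ring_of_type_algebra_def)
  then have one: "reduction g k \<one>\<^bsub>?L\<^esub> = \<one>\<^bsub>?Q\<^esub>"
    by (simp add: reduction_def congruence_quotient_def lamplighter_def semidirect_def Let_def
        integer_group_def integer_mod_group_def FactRing_def ring_of_type_algebra_def)
  have "group (?Q\<lparr>carrier := reduction g k ` carrier ?L, one := reduction g k \<one>\<^bsub>?L\<^esub>\<rparr>)"
    by (rule group.hom_imp_img_group[OF group_lamplighter epi(1)])
  then show ?thesis by (simp add: epi(2) one)
qed

end

theory Submission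
  imports Defs
begin

text \<open>
  Some power \<open>(0, e)\<close> of the generator of \<open>\<int>\<close>, with \<open>e > 0\<close>, has all its conjugates in \<open>H\<close>.
  The conjugate by \<open>(f, 0)\<close> is \<open>(f - t\<^sup>e f, e)\<close>; multiplying by a power of \<open>(0, e)\<close> shows that
  \<open>H\<close> contains every \<open>((t\<^sup>e - 1) f, e j)\<close>, that is, the kernel of the reduction modulo
  \<open>g = t\<^sup>e - 1\<close> and \<open>k = e\<close>. The quotient is finite since every Laurent polynomial has a
  remainder supported in \<open>{0..<e}\<close> modulo \<open>t\<^sup>e - 1\<close>.
\<close>

section \<open>Cosets and divisibility in the Laurent polynomial ring\<close>

lemma lamplighter_simps:
  "carrier lamplighter = UNIV"
  "\<one>\<^bsub>lamplighter\<^esub> = (0, 0)"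
  by (simp_all add: lamplighter_def semidirect_def ring_of_type_algebra_def integer_group_def)

lemma laurent_ring_simps:
  "carrier laurent_ring = UNIV"
  "a \<otimes>\<^bsub>laurent_ring\<^esub> b = a * b"
  "a \<oplus>\<^bsub>laurent_ring\<^esub> b = a + b"
  "\<zero>\<^bsub>laurent_ring\<^esub> = 0"
  by (simp_all add: ring_of_type_algebra_def)

lemma mem_PIdl_laurent_iff: "f \<in> PIdl\<^bsub>laurent_ring\<^esub> g \<longleftrightarrow> g dvd f"
  by (auto simp: cgenideal_def laurent_ring_simps dvd_def mult.commute)

lemma laurent_coset_eq_iff:
  fixes g :: "'p::prime_card laurent"
  shows "PIdl\<^bsub>laurent_ring\<^esub> g +>\<^bsub>laurent_ring\<^esub> a = PIdl\<^bsub>laurent_ring\<^esub> g +>\<^bsub>laurent_ring\<^esub> b \<longleftrightarrow> g dvd a - b"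
proof -
  have *: "PIdl\<^bsub>laurent_ring\<^esub> g +>\<^bsub>laurent_ring\<^esub> c = {h. g dvd h - c}" for c
    by (auto simp: a_r_coset_def' mem_PIdl_laurent_iff laurent_ring_simps intro: exI[of _ "_ - c"])
  show ?thesis
  proof
    assume "g dvd a - b"
    then have "g dvd h - a \<longleftrightarrow> g dvd h - b" for h
      using dvd_add_left_iff[of g "a - b" "h - a"] by simp
    then show "PIdl\<^bsub>laurent_ring\<^esub> g +>\<^bsub>laurent_ring\<^esub> a = PIdl\<^bsub>laurent_ring\<^esub> g +>\<^bsub>laurent_ring\<^esub> b"
      unfolding * by simp
  next
    assume "PIdl\<^bsub>laurent_ring\<^esub> g +>\<^bsub>laurent_ring\<^esub> a = PIdl\<^bsub>laurent_ring\<^esub> g +>\<^bsub>laurent_ring\<^esub> b"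
    then have "a \<in> {h. g dvd h - b}"
      unfolding *[symmetric] by (metis * diff_self dvd_0_right mem_Collect_eq)
    then show "g dvd a - b" by simp
  qed
qed

text \<open>A telescoping argument, run in both directions because \<open>z\<close> may be negative;
  the downward step uses that \<open>tpow k\<close> is a unit.\<close>

lemma tpow_minus_1_dvd_tpow_mult:
  fixes k z :: int
  shows "(tpow k - 1 :: 'p::prime_card laurent) dvd tpow (k * z) - 1"
proof (induction z rule: int_induct[where k = 0])
  case base
  show ?case by (simp add: tpow_0)
next
  case (step1 i)
  have "tpow (k * (i + 1)) - 1 = tpow k * (tpow (k * i) - 1) + (tpow k - (1 :: 'p laurent))"
    by (simp add: tpow_add[symmetric] algebra_simps)
  with step1.IH show ?case by (simp only: dvd_add dvd_mult dvd_refl)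
next
  case (step2 i)
  have "tpow (k * (i - 1)) - 1
      = tpow (- k) * ((tpow (k * i) - 1) - (tpow k - (1 :: 'p laurent)))"
    by (simp add: tpow_add[symmetric] algebra_simps tpow_0)
  then show ?case using step2.IH by (metis dvd_diff dvd_mult dvd_refl)
qed

lemma tpow_minus_1_dvd_diff_mod:
  fixes k n :: int
  shows "(tpow k - 1 :: 'p::prime_card laurent) dvd tpow n - tpow (n mod k)"
proof -
  have "tpow n - (tpow (n mod k) :: 'p laurent)
      = tpow (n mod k) * (tpow (k * (n div k)) - 1)"
    by (simp add: tpow_add[symmetric] right_diff_distrib)
  then show ?thesis by (metis dvd_mult tpow_minus_1_dvd_tpow_mult)
qed

section \<open>Finiteness of the quotient modulo \<open>tpow k - 1\<close>\<close>

lemma single_eq_mult_tpow: "Poly_Mapping.single n c = Poly_Mapping.single 0 c * tpow n"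
  by (simp add: tpow_def mult_single)

text \<open>\<open>lookup\<close> embeds these mappings into the functions from the finite set
  \<open>S\<close> to a finite type, extended by zero.\<close>

lemma finite_poly_mapping_keys_subset:
  assumes "finite S"
  shows "finite {f :: 'a \<Rightarrow>\<^sub>0 'b::{zero,finite}. Poly_Mapping.keys f \<subseteq> S}"
proof (rule finite_imageD)
  have "finite {h :: 'a \<Rightarrow> 'b. \<forall>x. (x \<in> S \<longrightarrow> h x \<in> UNIV) \<and> (x \<notin> S \<longrightarrow> h x = 0)}"
    by (rule finite_set_of_finite_funs) (use assms in auto)
  then show "finite (Poly_Mapping.lookup ` {f :: 'a \<Rightarrow>\<^sub>0 'b. Poly_Mapping.keys f \<subseteq> S})"
    by (rule finite_subset[rotated]) (auto simp: in_keys_iff subset_iff)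
qed (simp add: inj_on_def poly_mapping.lookup_inject)

text \<open>The polynomial is built up one monomial at a time, and each exponent is reduced modulo
  \<open>k\<close>. Negative exponents need no separate treatment, since \<open>n mod k\<close>
  always lies in \<open>{0..<k}\<close>.\<close>

lemma tpow_minus_1_remainder:
  fixes f :: "'p::prime_card laurent" and k :: int
  assumes "k > 0"
  shows "\<exists>r. Poly_Mapping.keys r \<subseteq> {0..<k} \<and> (tpow k - 1) dvd f - r"
proof (induction f rule: Poly_Mapping.update_induct)
  case const
  show ?case by (intro exI[of _ 0]) simp
next
  case (update f n c)
  then obtain r where r: "Poly_Mapping.keys r \<subseteq> {0..<k}" "(tpow k - 1) dvd f - r"
    by blast
  define s where "s = Poly_Mapping.single (n mod k) c"
  have s: "Poly_Mapping.keys s \<subseteq> {0..<k}"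
    using assms by (simp add: s_def)
  have "Poly_Mapping.single n c - s = Poly_Mapping.single 0 c * (tpow n - tpow (n mod k))"
    unfolding s_def by (subst (1 2) single_eq_mult_tpow) (simp add: right_diff_distrib)
  then have "(tpow k - 1) dvd Poly_Mapping.single n c - s"
    by (metis dvd_mult tpow_minus_1_dvd_diff_mod)
  then have "(tpow k - 1) dvd (Poly_Mapping.single n c - s) + (f - r)"
    using r(2) by (rule dvd_add)
  \<comment> \<open>The update is a sum because \<open>n\<close> is outside the support of
    \<open>f\<close>, so the overwritten coefficient is 0.\<close>
  moreover have "Poly_Mapping.update n c f = Poly_Mapping.single n c + f"
    using update.hyps
    by (intro poly_mapping_eqI) (auto simp: lookup_update lookup_add lookup_single in_keys_iff when_def)
  ultimately have "(tpow k - 1) dvd Poly_Mapping.update n c f - (s + r)"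
    by (simp add: algebra_simps)
  moreover have "Poly_Mapping.keys (s + r) \<subseteq> {0..<k}"
    using Poly_Mapping.keys_add[of s r] r(1) s by blast
  ultimately show ?case by blast
qed

lemma finite_congruence_quotient:
  assumes "k > 0"
  shows "finite (carrier (congruence_quotient (tpow (int k) - 1 :: 'p::prime_card laurent) k))"
proof -
  let ?I = "PIdl\<^bsub>laurent_ring\<^esub> (tpow (int k) - 1 :: 'p laurent)"
  have "carrier (laurent_ring Quot ?I)
      \<subseteq> (\<lambda>r. ?I +>\<^bsub>laurent_ring\<^esub> r) ` {r. Poly_Mapping.keys r \<subseteq> {0..<int k}}"
  proof
    fix C assume "C \<in> carrier (laurent_ring Quot ?I)"
    then obtain f where C: "C = ?I +>\<^bsub>laurent_ring\<^esub> f"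
      by (auto simp: FactRing_def A_RCOSETS_def')
    obtain r where "Poly_Mapping.keys r \<subseteq> {0..<int k}" "(tpow (int k) - 1) dvd f - r"
      using tpow_minus_1_remainder[of "int k" f] assms by auto
    then show "C \<in> (\<lambda>r. ?I +>\<^bsub>laurent_ring\<^esub> r) ` {r. Poly_Mapping.keys r \<subseteq> {0..<int k}}"
      using C laurent_coset_eq_iff by blast
  qed
  then have "finite (carrier (laurent_ring Quot ?I))"
    by (rule finite_subset) (simp add: finite_poly_mapping_keys_subset)
  then show ?thesis
    using assms
    by (simp add: congruence_quotient_def semidirect_def Let_def integer_mod_group_def)
qed

section \<open>Kernels of the reductions\<close>

text \<open>The induced map from the quotient by the kernel into \<open>carrier H\<close> is
  injective.\<close>

lemma (in group_hom) finite_rcosets_kernel: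
  assumes "finite (carrier H)"
  shows "finite (rcosets (kernel G H h))"
proof -
  have "(\<lambda>C. the_elem (h ` C)) ` carrier (G Mod kernel G H h) \<subseteq> carrier H"
    using FactGroup_the_elem_mem by blast
  then have "finite (carrier (G Mod kernel G H h))"
    by (intro finite_imageD[OF _ FactGroup_inj_on] finite_subset[OF _ assms])
  then show ?thesis by (simp add: FactGroup_def)
qed

lemma kernel_reduction:
  assumes "k > 0"
  shows "kernel lamplighter (congruence_quotient g k) (reduction g k)
       = {(f, n). g dvd f \<and> int k dvd (n :: int)}"
proof -
  \<comment> \<open>With the ideal written as the coset of 0, kernel membership becomes an equality
    of two cosets, hence a divisibility.\<close>
  have "\<one>\<^bsub>congruence_quotient g k\<^esub> = (PIdl\<^bsub>laurent_ring\<^esub> g +>\<^bsub>laurent_ring\<^esub> 0, 0)"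
    by (simp add: congruence_quotient_def semidirect_def Let_def integer_mod_group_def
        FactRing_def a_r_coset_def' laurent_ring_simps)
  then show ?thesis
    by (simp add: kernel_def reduction_def lamplighter_simps laurent_coset_eq_iff
        case_prod_unfold mod_eq_0_iff_dvd)
qed

text \<open>These are the subgroups that will be found inside \<open>H\<close>. For this modulus the
  condition that \<open>tpow k\<close> be congruent to 1 is automatic.\<close>

lemma principal_congruence_subgroup_tpow_minus_1:
  assumes "k > 0"
  shows "principal_congruence_subgroup
    {(f :: 'p::prime_card laurent, n). (tpow (int k) - 1) dvd f \<and> int k dvd n}"
proof -
  let ?g = "tpow (int k) - 1 :: 'p laurent"
  have g: "?g \<in> PIdl\<^bsub>laurent_ring\<^esub> ?g" by (simp add: mem_PIdl_laurent_iff)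
  note epi = reduction_epi[OF assms g]
  interpret group_hom lamplighter "congruence_quotient ?g k" "reduction ?g k"
    using epi by (intro group_hom.intro group_hom_axioms.intro group_lamplighter
        group_congruence_quotient[OF assms g]) (simp add: epi_def)
  show ?thesis
    unfolding principal_congruence_subgroup_def finite_index_subgroup_def
      kernel_reduction[OF assms, symmetric]
    using epi g assms normal_kernel subgroup_kernel
      finite_rcosets_kernel[OF finite_congruence_quotient[OF assms]]
    by blast
qed

section \<open>A uniform power in all conjugates of a finite-index subgroup\<close>

text \<open>
  Pigeonhole on the right translations by powers of \<open>x\<close>, viewed as self-maps of the coset space.
\<close>

lemma (in group) finite_index_power_in_core:
  assumes H: "finite_index_subgroup H G" and x: "x \<in> carrier G"
  obtains e :: nat where "e > 0" "\<And>y. y \<in> carrier G \<Longrightarrow> y \<otimes> x [^] e \<otimes> inv y \<in> H"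
proof -
  have sub: "subgroup H G" and fin: "finite (rcosets H)"
    using H by (simp_all add: finite_index_subgroup_def)
  have HG: "H \<subseteq> carrier G" by (rule subgroup.subset[OF sub])
  \<comment> \<open>Restriction to the cosets makes each \<open>\<phi> n\<close> extensional, so
    that all of them lie in one finite function space.\<close>
  define \<phi> where "\<phi> n = (\<lambda>C\<in>rcosets H. C #> x [^] n)" for n :: nat
  have "C #> x [^] n \<in> rcosets H" if "C \<in> rcosets H" for C and n :: nat
    using that x HG by (auto simp: RCOSETS_def coset_mult_assoc intro!: bexI[of _ "_ \<otimes> x [^] n"])
  then have "\<phi> n \<in> (rcosets H) \<rightarrow>\<^sub>E (rcosets H)" for n
    unfolding \<phi>_def by (intro PiE_I) simp_all
  then have "range \<phi> \<subseteq> (rcosets H) \<rightarrow>\<^sub>E (rcosets H)"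
    by blast
  then have "finite (range \<phi>)"
    using fin by (meson finite_PiE finite_subset)
  then have "\<not> inj \<phi>"
    using finite_imageD infinite_UNIV_nat by blast
  then obtain m n where "m < n" and eq: "\<phi> m = \<phi> n"
    by (metis injI linorder_neqE_nat)
  show thesis
  proof
    show "n - m > 0" using \<open>m < n\<close> by simp
    fix y assume y: "y \<in> carrier G"
    \<comment> \<open>Equal maps agree on the coset of every \<open>y\<close>; since
      \<open>m\<close> and \<open>n\<close> were fixed before \<open>y\<close>, one exponent serves
      all conjugates.\<close>
    have "H #> (y \<otimes> x [^] m) = H #> (y \<otimes> x [^] n)"
      using fun_cong[OF eq, of "H #> y"] x y HG
      by (simp add: \<phi>_def rcosetsI coset_mult_assoc)
    then have "y \<otimes> x [^] n \<in> H #> (y \<otimes> x [^] m)"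
      by (rule ssubst) (intro rcos_self sub m_closed y nat_pow_closed x)
    then obtain h where h: "h \<in> H" "y \<otimes> x [^] n = h \<otimes> (y \<otimes> x [^] m)"
      by (auto simp: r_coset_def)
    have hG: "h \<in> carrier G" using h(1) HG by blast
    have "x [^] n = x [^] (n - m) \<otimes> x [^] m"
      using x \<open>m < n\<close> by (simp add: nat_pow_mult)
    then have "(y \<otimes> x [^] (n - m)) \<otimes> x [^] m = (h \<otimes> y) \<otimes> x [^] m"
      using h(2) x y hG by (simp only: m_assoc nat_pow_closed)
    then have "y \<otimes> x [^] (n - m) = h \<otimes> y"
      using x y hG by (simp only: r_cancel m_closed nat_pow_closed)
    then show "y \<otimes> x [^] (n - m) \<otimes> inv y \<in> H"
      using h(1) y hG by (simp add: m_assoc)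
  qed
qed

section \<open>Finding a congruence kernel inside \<open>H\<close>\<close>

lemma lamplighter_pow_generator:
  "(0, 1) [^]\<^bsub>lamplighter\<^esub> e = (0 :: 'p::prime_card laurent, int e)"
  by (induction e) (simp_all add: lamplighter_simps lamplighter_mult)

lemma lamplighter_inv:
  "inv\<^bsub>lamplighter\<^esub> (f, n) = (- tpow (- n) * f, - n)" for f :: "'p::prime_card laurent"
  by (rule group.inv_equality[OF group_lamplighter])
    (simp_all add: lamplighter_simps lamplighter_mult)

theorem proposition2:
  fixes H :: "('p::prime_card laurent \<times> int) set"
  assumes "finite_index_subgroup H lamplighter"
  shows "congruence_subgroup H"
proof -
  interpret group "lamplighter :: ('p laurent \<times> int) monoid" by (rule group_lamplighter)
  interpret subgroup H lamplighter using assms by (simp add: finite_index_subgroup_def)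
  obtain e :: nat where "e > 0" and
    core: "\<And>y. y \<otimes>\<^bsub>lamplighter\<^esub> (0, 1) [^]\<^bsub>lamplighter\<^esub> e \<otimes>\<^bsub>lamplighter\<^esub> inv\<^bsub>lamplighter\<^esub> y \<in> H"
    using finite_index_power_in_core[OF assms, of "(0, 1)"] by (auto simp: lamplighter_simps)
  have twist: "(f - tpow (int e) * f, int e) \<in> H" for f
    using core[of "(f, 0)"]
    by (simp add: lamplighter_pow_generator lamplighter_inv lamplighter_mult tpow_0)
  \<comment> \<open>These are the integer powers of \<open>(0, int e)\<close>, which is
    \<open>twist\<close> at 0.\<close>
  have shift: "(0, int e * j) \<in> H" for j
  proof (induction j rule: int_induct[where k = 0])
    case base
    then show ?case using one_closed by (simp add: lamplighter_simps)
  next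
    case (step1 i)
    then show ?case using m_closed[OF step1.IH twist[of 0]]
      by (simp add: lamplighter_mult algebra_simps)
  next
    case (step2 i)
    then show ?case using m_closed[OF step2.IH m_inv_closed[OF twist[of 0]]]
      by (simp add: lamplighter_mult lamplighter_inv algebra_simps)
  qed
  \<comment> \<open>The sign in \<open>- f\<close> turns \<open>1 - tpow (int e)\<close> into
    \<open>tpow (int e) - 1\<close>. The twisted element already contributes \<open>e\<close> to the
    second component, so only \<open>j - 1\<close> further shifts are needed, and these leave the
    first component unchanged.\<close>
  have "((tpow (int e) - 1) * f, int e * j) \<in> H" for f j
    using m_closed[OF twist[of "- f"] shift[of "j - 1"]]
    by (simp add: lamplighter_mult algebra_simps)
  then have "{(f, n). (tpow (int e) - 1) dvd f \<and> int e dvd n} \<subseteq> H"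
    by (auto elim!: dvdE)
  then show ?thesis
    using assms principal_congruence_subgroup_tpow_minus_1[OF \<open>e > 0\<close>]
    by (auto simp: congruence_subgroup_def)
qed

end
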